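(* Let $Z$ be a real Hilbert space, $X\subseteq Z$ a linear subspace, and let $\mathcal{A}:X\to Z$, $\mathcal{B}:\mathbb{R}^m\to Z$, $\mathcal{C}:X\to\mathbb{R}^q$, $\mathcal{D}:\mathbb{R}^m\to\mathbb{R}^q$ be linear operators. Consider the system $$\dot x(t)=\mathcal{A}x(t)+\mathcal{B}w(t),\qquad y(t)=\mathcal{C}x(t)+\mathcal{D}w(t),\qquad x(0)=0,\qquad x(t)\in X. \quad (\Sigma)$$ (A) Let $\gamma\ge 0$. Suppose there exists a coercive, self-adjoint linear operator $\mathcal{P}:Z\to Z$ such that $$\langle z,\mathcal{P}\mathcal{A}z\rangle_Z+\langle \mathcal{A}z,\mathcal{P}z\rangle_Z+\langle z,\mathcal{P}\mathcal{B}u\rangle_Z+\langle\mathcal{B}u,\mathcal{P}z\rangle_Z\le \gamma^2 u^Tu-(\mathcal{C}z)^T\mathcal{C}z-(\mathcal{C}z)^T\mathcal{D}u-(\mathcal{D}u)^T\mathcal{C}z-(\mathcal{D}u)^T\mathcal{D}u$$ for all $z\in X$ and $u\in\mathbb{R}^m$. Then for any $w\in L_2^m([0,\infty))$ and $y\in L_2^q([0,\infty))$ which satisfy $(\Sigma)$ for some $x$, we have $\|y\|_{L_2}\le\gamma\|w\|_{L_2}$. (B) Let $m=q$. Suppose there exists a coercive, self-adjoint linear operator $\mathcal{P}:Z\to Z$ such that $$\langle z,\mathcal{P}\mathcal{A}z\rangle_Z+\langle \mathcal{A}z,\mathcal{P}z\rangle_Z+\langle z,\mathcal{P}\mathcal{B}u\rangle_Z+\langle\mathcal{B}u,\mathcal{P}z\rangle_Z\le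 (\mathcal{C}z)^Tu+u^T\mathcal{C}z+(\mathcal{D}u)^Tu+u^T\mathcal{D}u$$ for all $z\in X$ and $u\in\mathbb{R}^q$. Then for any $w\in L_2^q([0,\infty))$ and $y\in L_2^q([0,\infty))$ which satisfy $(\Sigma)$ for some $x$, we have $\langle w,y\rangle_{L_2}\ge 0$.
   Context: An operator $\mathcal{P}:Z\to Z$ is coercive if there is $\epsilon>0$ with $\langle z,\mathcal{P}z\rangle_Z\ge\epsilon\|z\|_Z^2$ for all $z\in Z$. $L_2^k([0,\infty))$ is the space of square-integrable $\mathbb{R}^k$-valued functions with $\langle f,g\rangle_{L_2}=\int_0^\infty f(t)^Tg(t)\,dt$. "$w,y$ satisfy $(\Sigma)$ for some $x$" means: there is a function $x:[0,\infty)\to Z$, locally absolutely continuous and (norm) differentiable almost everywhere, with $x(0)=0$ and, for almost every $t\ge0$, $x(t)\in X$ and the two equations in $(\Sigma)$ hold. *)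

theory Defs
  imports "HOL-Analysis.Analysis"
begin

text \<open>
  An operator defined on a subspace \<open>X\<close> is a total function of which only the
  values on \<open>X\<close> are relevant.
\<close>

definition linear_on :: "'a::real_vector set \<Rightarrow> ('a \<Rightarrow> 'b::real_vector) \<Rightarrow> bool" where
  "linear_on X f \<longleftrightarrow>
     (\<forall>x\<in>X. \<forall>y\<in>X. f (x + y) = f x + f y) \<and> (\<forall>c. \<forall>x\<in>X. f (c *\<^sub>R x) = c *\<^sub>R f x)"

definition coercive :: "('z::real_inner \<Rightarrow> 'z) \<Rightarrow> bool" where
  "coercive P \<longleftrightarrow> (\<exists>\<epsilon>>0. \<forall>z. z \<bullet> P z \<ge> \<epsilon> * (norm z)\<^sup>2)"

text \<open>
  For an operator defined on the whole space, self-adjointness is symmetry. The library constant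
  \<^const>\<open>adjoint\<close> is a Hilbert choice, unspecified when no adjoint exists, so
  \<open>adjoint P = P\<close> would not be a safe rendering.
\<close>

definition self_adjoint :: "('z::real_inner \<Rightarrow> 'z) \<Rightarrow> bool" where
  "self_adjoint P \<longleftrightarrow> (\<forall>x y. P x \<bullet> y = x \<bullet> P y)"

text \<open>
  Square-integrable functions on the half-line, as representatives: functions on
  \<open>real\<close> of which only the values on \<open>{0..}\<close> are relevant.
\<close>

definition L2 :: "(real \<Rightarrow> real ^ 'k) set" where
  "L2 = {f. set_borel_measurable lebesgue {0..} f \<and>
            set_integrable lebesgue {0..} (\<lambda>t. (norm (f t))\<^sup>2)}"

definition L2_inner :: "(real \<Rightarrow> real ^ 'k) \<Rightarrow> (real \<Rightarrow> real ^ 'k) \<Rightarrow> real" where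
  "L2_inner f g = (LINT t:{0..}|lebesgue. f t \<bullet> g t)"

definition L2_norm :: "(real \<Rightarrow> real ^ 'k) \<Rightarrow> real" where
  "L2_norm f = sqrt (L2_inner f f)"

text \<open>
  Absolute continuity of functions; the library's \<^const>\<open>absolutely_continuous\<close>
  is about measures.
\<close>

definition abs_cont_on :: "real set \<Rightarrow> (real \<Rightarrow> 'z::real_normed_vector) \<Rightarrow> bool" where
  "abs_cont_on S f \<longleftrightarrow>
     (\<forall>\<epsilon>>0. \<exists>\<delta>>0. \<forall>(n::nat) l r.
        (\<forall>i<n. l i \<le> r i \<and> {l i..r i} \<subseteq> S) \<longrightarrow>
        disjoint_family_on (\<lambda>i. {l i<..<r i}) {..<n} \<longrightarrow>
        (\<Sum>i<n. r i - l i) < \<delta> \<longrightarrow>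
        (\<Sum>i<n. norm (f (r i) - f (l i))) < \<epsilon>)"

definition locally_abs_cont_on :: "real set \<Rightarrow> (real \<Rightarrow> 'z::real_normed_vector) \<Rightarrow> bool" where
  "locally_abs_cont_on S f \<longleftrightarrow> (\<forall>a b. {a..b} \<subseteq> S \<longrightarrow> abs_cont_on {a..b} f)"

text \<open>
  The almost everywhere differentiability of \<open>x\<close> is part of the
  \<^const>\<open>has_vector_derivative\<close> conjunct, a norm derivative.
\<close>

definition satisfies_system ::
  "'z::real_inner set \<Rightarrow> ('z \<Rightarrow> 'z) \<Rightarrow> (real ^ 'm \<Rightarrow> 'z) \<Rightarrow> ('z \<Rightarrow> real ^ 'q) \<Rightarrow>
   (real ^ 'm \<Rightarrow> real ^ 'q) \<Rightarrow> (real \<Rightarrow> real ^ 'm) \<Rightarrow> (real \<Rightarrow> real ^ 'q) \<Rightarrow> (real \<Rightarrow> 'z) \<Rightarrow> bool" where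
  "satisfies_system X A B C D w y x \<longleftrightarrow>
     locally_abs_cont_on {0..} x \<and> x 0 = 0 \<and>
     (AE t in lebesgue. t \<ge> 0 \<longrightarrow>
        x t \<in> X \<and>
        (x has_vector_derivative A (x t) + B (w t)) (at t within {0..}) \<and>
        y t = C (x t) + D (w t))"

end

theory Submission
  imports Defs
begin

text \<open>
  Along a trajectory, the storage function \<open>V t = x t \<bullet> P (x t)\<close> has almost everywhere a derivative
  bounded by the supply rate, which is \<open>\<gamma>\<^sup>2 * (w \<bullet> w) - y \<bullet> y\<close> in the first part and
  \<open>2 * (w \<bullet> y)\<close> in the second. By the Hellinger--Toeplitz theorem the symmetric operator \<open>P\<close> is
  bounded, so \<open>V\<close> is absolutely continuous on compact intervals, and hence \<open>V T - V 0\<close> is at most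
  the integral of the supply rate over \<open>{0..T}\<close>. Since \<open>V 0 = 0 \<le> V T\<close>, letting \<open>T\<close> tend to
  infinity gives both claims.
\<close>

section \<open>Boundedness of symmetric operators\<close>

text \<open>
  Hellinger--Toeplitz: by Baire, the functionals \<open>z \<mapsto> z \<bullet> P u\<close> with \<open>norm u \<le> 1\<close>, which are
  pointwise bounded because \<open>z \<bullet> P u = P z \<bullet> u\<close>, are uniformly bounded on a ball.
\<close>

lemma symmetric_bounded_linear:
  fixes P :: "'z::{real_inner, banach} \<Rightarrow> 'z"
  assumes lin: "linear P" and sym: "self_adjoint P"
  shows "bounded_linear P"
proof -
  interpret linear P by (fact lin)
  have adj: "P x \<bullet> y = x \<bullet> P y" for x y
    using sym by (simp add: self_adjoint_def)
  define F where "F n = {z. \<forall>u. norm u \<le> 1 \<longrightarrow> \<bar>z \<bullet> P u\<bar> \<le> real n}" for n :: nat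
  have closed_F: "closed (F n)" for n
    unfolding F_def by (intro closed_Collect_all closed_Collect_imp closed_Collect_le
        continuous_intros) simp_all
  have "z \<in> F (nat \<lceil>norm (P z)\<rceil>)" for z
  proof -
    have "\<bar>z \<bullet> P u\<bar> \<le> norm (P z)" if "norm u \<le> 1" for u
      using Cauchy_Schwarz_ineq2[of "P z" u] mult_left_le[OF that, of "norm (P z)"]
      by (simp add: adj)
    then show ?thesis
      unfolding F_def using of_nat_ceiling order_trans by blast
  qed
  then have cover: "\<Union>(range F) = UNIV"
    by blast
  have "\<exists>n. interior (F n) \<noteq> {}"
  proof (rule ccontr)
    assume "\<not> ?thesis"
    then have "euclidean interior_of \<Union>(range F) = {}"
      using closed_F completely_metrizable_space_euclidean
      by (intro Baire_category_alt) auto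
    then show False
      by (simp add: cover)
  qed
  then obtain n a where "a \<in> interior (F n)"
    by blast
  then obtain r where r: "r > 0" "cball a r \<subseteq> F n"
    by (meson mem_interior_cball)
  \<comment> \<open>Membership in \<open>F n\<close> is known only near \<open>a\<close>;
    subtracting the bounds at \<open>a\<close> and \<open>a + h\<close> moves it to the origin. This
    costs the factor 2, and rescaling \<open>h\<close> to \<open>z\<close> gives the factor
    \<open>norm z / r\<close>.\<close>
  have bound: "\<bar>u \<bullet> P z\<bar> \<le> 2 * real n / r * norm z" if u: "norm u \<le> 1" for u z
  proof (cases "z = 0")
    case False
    \<comment> \<open>The multiple of \<open>z\<close> of length \<open>r\<close>, so that
      \<open>a + h\<close> still lies in \<open>cball a r\<close>.\<close>
    define h where "h = (r / norm z) *\<^sub>R z"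
    have "norm h = r"
      using r False by (simp add: h_def)
    then have "a \<in> F n" "a + h \<in> F n"
      using r by (auto simp: subset_iff dist_norm)
    then have "\<bar>a \<bullet> P u\<bar> \<le> real n" "\<bar>(a + h) \<bullet> P u\<bar> \<le> real n"
      using u by (auto simp: F_def)
    then have "\<bar>h \<bullet> P u\<bar> \<le> 2 * real n"
      by (simp add: inner_add_left)
    moreover have "h \<bullet> P u = u \<bullet> P h"
      by (metis adj inner_commute)
    then have "h \<bullet> P u = (r / norm z) * (u \<bullet> P z)"
      by (simp add: h_def scale)
    ultimately have "(r / norm z) * \<bar>u \<bullet> P z\<bar> \<le> 2 * real n"
      using r by (simp add: abs_mult)
    then show ?thesis
      using r False by (simp add: field_simps)
  qed (simp add: zero)
  \<comment> \<open>The unit vector in the direction of \<open>P z\<close> turns the bound on inner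
    products into a bound on the norm; \<open>sgn 0 = 0\<close> covers the case
    \<open>P z = 0\<close>.\<close>
  have "norm (P z) \<le> norm z * (2 * real n / r)" for z
  proof -
    have "sgn (P z) \<bullet> P z = norm (P z)"
      by (cases "P z = 0") (simp_all add: sgn_div_norm dot_square_norm power2_eq_square)
    then show ?thesis
      using bound[of "sgn (P z)" z] by (simp add: norm_sgn mult.commute)
  qed
  then show ?thesis
    by (intro bounded_linear_intro[of P] add scale)
qed

section \<open>Absolutely continuous functions\<close>

text \<open>Reindexing along a bijection with \<open>{..<card I}\<close> frees the definition from
  natural-number indices, so that tagged intervals can serve as their own index set.\<close>

lemma abs_cont_on_finite_family:
  fixes f :: "real \<Rightarrow> 'z::real_normed_vector"
  assumes "abs_cont_on S f" "\<epsilon> > 0"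
  shows "\<exists>\<delta>>0. \<forall>(I :: 'i set) l r. finite I \<longrightarrow> (\<forall>i\<in>I. l i \<le> r i \<and> {l i..r i} \<subseteq> S) \<longrightarrow>
       disjoint_family_on (\<lambda>i. {l i<..<r i}) I \<longrightarrow> (\<Sum>i\<in>I. r i - l i) < \<delta> \<longrightarrow>
       (\<Sum>i\<in>I. norm (f (r i) - f (l i))) < \<epsilon>"
proof -
  obtain \<delta> where \<delta>: "\<delta> > 0"
    "\<forall>(n::nat) l r. (\<forall>i<n. l i \<le> r i \<and> {l i..r i} \<subseteq> S) \<longrightarrow>
       disjoint_family_on (\<lambda>i. {l i<..<r i}) {..<n} \<longrightarrow> (\<Sum>i<n. r i - l i) < \<delta> \<longrightarrow>
       (\<Sum>i<n. norm (f (r i) - f (l i))) < \<epsilon>"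
    using assms(1)[unfolded abs_cont_on_def, rule_format, OF assms(2)] by (elim exE conjE)
  show ?thesis
  proof (intro exI[of _ \<delta>] conjI allI impI)
    fix I :: "'i set" and l r
    assume I: "finite I" "\<forall>i\<in>I. l i \<le> r i \<and> {l i..r i} \<subseteq> S"
      and disj: "disjoint_family_on (\<lambda>i. {l i<..<r i}) I"
      and small: "(\<Sum>i\<in>I. r i - l i) < \<delta>"
    obtain h where h: "bij_betw h {..<card I} I"
      using ex_bij_betw_nat_finite[OF I(1)] by (auto simp: atLeast0LessThan)
    have sums: "(\<Sum>i<card I. \<phi> (h i)) = sum \<phi> I" for \<phi> :: "'i \<Rightarrow> real"
      by (rule sum.reindex_bij_betw[OF h])
    have "disjoint_family_on (\<lambda>i. {l (h i)<..<r (h i)}) {..<card I}"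
      unfolding disjoint_family_on_def
    proof (intro ballI impI)
      fix i j assume ij: "i \<in> {..<card I}" "j \<in> {..<card I}" "i \<noteq> j"
      then have "h i \<in> I" "h j \<in> I" "h i \<noteq> h j"
        using h by (auto simp: bij_betw_def inj_on_def)
      then show "{l (h i)<..<r (h i)} \<inter> {l (h j)<..<r (h j)} = {}"
        by (rule disjoint_family_onD[OF disj])
    qed
    moreover have "\<forall>i<card I. l (h i) \<le> r (h i) \<and> {l (h i)..r (h i)} \<subseteq> S"
      using h I(2) by (auto simp: bij_betw_def)
    ultimately show "(\<Sum>i\<in>I. norm (f (r i) - f (l i))) < \<epsilon>"
      using \<delta>(2)[THEN spec, THEN spec, THEN spec, of "card I" "\<lambda>i. l (h i)" "\<lambda>i. r (h i)"] small
        sums[of "\<lambda>i. r i - l i"] sums[of "\<lambda>i. norm (f (r i) - f (l i))"]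
      by simp
  qed (fact \<delta>(1))
qed

lemma abs_cont_on_imp_continuous_on:
  fixes f :: "real \<Rightarrow> 'z::real_normed_vector"
  assumes "abs_cont_on {a..b} f"
  shows "continuous_on {a..b} f"
  unfolding continuous_on_iff
proof (intro ballI allI impI)
  fix s and e :: real
  assume s: "s \<in> {a..b}" and "e > 0"
  obtain \<delta> where \<delta>: "\<delta> > 0"
    "\<forall>(I :: unit set) l r. finite I \<longrightarrow> (\<forall>i\<in>I. l i \<le> r i \<and> {l i..r i} \<subseteq> {a..b}) \<longrightarrow>
       disjoint_family_on (\<lambda>i. {l i<..<r i}) I \<longrightarrow> (\<Sum>i\<in>I. r i - l i) < \<delta> \<longrightarrow>
       (\<Sum>i\<in>I. norm (f (r i) - f (l i))) < e"
    using abs_cont_on_finite_family[OF assms \<open>e > 0\<close>] by (elim exE conjE)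
  \<comment> \<open>A family of a single interval, with endpoints \<open>s\<close> and
    \<open>t\<close> in the right order.\<close>
  have "dist (f t) (f s) < e" if "t \<in> {a..b}" "dist t s < \<delta>" for t
    using \<delta>(2)[THEN spec, THEN spec, THEN spec, of UNIV "\<lambda>_. min s t" "\<lambda>_. max s t"] that s
    by (auto simp: UNIV_unit disjoint_family_on_def dist_norm min_def max_def norm_minus_commute
        split: if_splits)
  then show "\<exists>\<delta>>0. \<forall>t\<in>{a..b}. dist t s < \<delta> \<longrightarrow> dist (f t) (f s) < e"
    using \<delta>(1) by blast
qed

text \<open>A bounded quadratic form is Lipschitz on bounded sets, and \<open>x\<close> is bounded
  on the compact interval by continuity. Composition with a Lipschitz map preserves absolute
  continuity.\<close>

lemma abs_cont_on_quadratic_form: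
  fixes x :: "real \<Rightarrow> 'z::real_inner"
  assumes P: "bounded_linear P" and x: "abs_cont_on {a..b} x"
  shows "abs_cont_on {a..b} (\<lambda>t. x t \<bullet> P (x t))"
proof -
  interpret P: bounded_linear P by (fact P)
  obtain K where K: "K > 0" "\<And>z. norm (P z) \<le> norm z * K"
    using P.pos_bounded by blast
  have "bounded (x ` {a..b})"
    using abs_cont_on_imp_continuous_on[OF x] compact_Icc compact_continuous_image
      compact_imp_bounded by blast
  then obtain M where M: "M > 0" "\<And>t. t \<in> {a..b} \<Longrightarrow> norm (x t) \<le> M"
    unfolding bounded_pos by blast
  \<comment> \<open>Splitting the increment as in \<open>eq\<close> below gives two terms, each at
    most \<open>M * K * norm (x t - x s)\<close>.\<close>
  define L where "L = 2 * M * K"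
  have "L > 0"
    using K M by (simp add: L_def)
  have lip: "norm (x t \<bullet> P (x t) - x s \<bullet> P (x s)) \<le> L * norm (x t - x s)"
    if "s \<in> {a..b}" "t \<in> {a..b}" for s t
  proof -
    have eq: "x t \<bullet> P (x t) - x s \<bullet> P (x s) = (x t - x s) \<bullet> P (x t) + x s \<bullet> P (x t - x s)"
      by (simp add: P.diff inner_diff_left inner_diff_right)
    have 1: "\<bar>(x t - x s) \<bullet> P (x t)\<bar> \<le> norm (x t - x s) * (M * K)"
    proof (rule order_trans[OF Cauchy_Schwarz_ineq2], intro mult_left_mono)
      show "norm (P (x t)) \<le> M * K"
        using K(2)[of "x t"] M(2)[OF that(2)] K(1) by (meson mult_right_mono less_imp_le order_trans)
    qed simp
    have 2: "\<bar>x s \<bullet> P (x t - x s)\<bar> \<le> M * (norm (x t - x s) * K)"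
      by (rule order_trans[OF Cauchy_Schwarz_ineq2], intro mult_mono K M that)
        (use M in auto)
    show ?thesis
      unfolding eq L_def using 1 2 by (simp add: algebra_simps)
  qed
  show ?thesis
    unfolding abs_cont_on_def
  proof (intro allI impI)
    fix \<epsilon> :: real assume "\<epsilon> > 0"
    then have "\<epsilon> / L > 0"
      using \<open>L > 0\<close> by simp
    obtain \<delta> where \<delta>: "\<delta> > 0"
      "\<forall>(n::nat) l r. (\<forall>i<n. l i \<le> r i \<and> {l i..r i} \<subseteq> {a..b}) \<longrightarrow>
         disjoint_family_on (\<lambda>i. {l i<..<r i}) {..<n} \<longrightarrow> (\<Sum>i<n. r i - l i) < \<delta> \<longrightarrow>
         (\<Sum>i<n. norm (x (r i) - x (l i))) < \<epsilon> / L"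
      using x[unfolded abs_cont_on_def, rule_format, OF \<open>\<epsilon> / L > 0\<close>] by (elim exE conjE)
    show "\<exists>\<delta>>0. \<forall>(n::nat) l r. (\<forall>i<n. l i \<le> r i \<and> {l i..r i} \<subseteq> {a..b}) \<longrightarrow>
        disjoint_family_on (\<lambda>i. {l i<..<r i}) {..<n} \<longrightarrow> (\<Sum>i<n. r i - l i) < \<delta> \<longrightarrow>
        (\<Sum>i<n. norm (x (r i) \<bullet> P (x (r i)) - x (l i) \<bullet> P (x (l i)))) < \<epsilon>"
    proof (intro exI[of _ \<delta>] conjI allI impI)
      fix n :: nat and l r :: "nat \<Rightarrow> real"
      assume lr: "\<forall>i<n. l i \<le> r i \<and> {l i..r i} \<subseteq> {a..b}"
        and "disjoint_family_on (\<lambda>i. {l i<..<r i}) {..<n}" "(\<Sum>i<n. r i - l i) < \<delta>"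
      then have "(\<Sum>i<n. norm (x (r i) - x (l i))) < \<epsilon> / L"
        by (intro \<delta>(2)[THEN spec, THEN spec, THEN spec, THEN mp, THEN mp, THEN mp])
      moreover have "(\<Sum>i<n. norm (x (r i) \<bullet> P (x (r i)) - x (l i) \<bullet> P (x (l i))))
          \<le> (\<Sum>i<n. L * norm (x (r i) - x (l i)))"
        using lr by (intro sum_mono lip) auto
      ultimately show "(\<Sum>i<n. norm (x (r i) \<bullet> P (x (r i)) - x (l i) \<bullet> P (x (l i)))) < \<epsilon>"
        using \<open>L > 0\<close> by (simp add: sum_distrib_left[symmetric] field_simps)
    qed (fact \<delta>(1))
  qed
qed

section \<open>Increments of absolutely continuous functions\<close>

text \<open>Intervals of a tagged division have disjoint interiors, so their total length is the
  measure of the union of these interiors, which lies in \<open>U\<close>. This supplies the two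
  premises of absolute continuity for the intervals in \<open>q\<close>.\<close>

lemma tagged_subdivision_total_length:
  assumes p: "p tagged_division_of {a..b::real}" and q: "q \<subseteq> p"
    and U: "U \<in> sets lebesgue" "\<And>i. i \<in> q \<Longrightarrow> snd i \<subseteq> U"
    and emU: "emeasure lebesgue U < ennreal \<delta>"
  shows "disjoint_family_on (\<lambda>i. {Inf (snd i)<..<Sup (snd i)}) q"
    and "(\<Sum>i\<in>q. Sup (snd i) - Inf (snd i)) < \<delta>"
proof -
  \<comment> \<open>The tag makes each interval nonempty, so \<open>Inf\<close> and
    \<open>Sup\<close> really are its endpoints.\<close>
  have K: "{Inf (snd i)<..<Sup (snd i)} = interior (snd i)" "Inf (snd i) \<le> Sup (snd i)"
    if "i \<in> q" for i
  proof -
    have i: "(fst i, snd i) \<in> p"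
      using that q by auto
    then obtain u v where "snd i = {u..v}"
      using tagged_division_ofD(4)[OF p i] by auto
    moreover have "fst i \<in> snd i"
      using tagged_division_ofD(2)[OF p i] .
    ultimately show "{Inf (snd i)<..<Sup (snd i)} = interior (snd i)" "Inf (snd i) \<le> Sup (snd i)"
      by (auto simp: interior_atLeastAtMost_real)
  qed
  show disj: "disjoint_family_on (\<lambda>i. {Inf (snd i)<..<Sup (snd i)}) q"
    unfolding disjoint_family_on_def
  proof (intro ballI impI)
    fix i j assume ij: "i \<in> q" "j \<in> q" "i \<noteq> j"
    then have "interior (snd i) \<inter> interior (snd j) = {}"
      using tagged_division_ofD(5)[OF p, of "fst i" "snd i" "fst j" "snd j"] q
      by (auto simp: prod_eq_iff)
    then show "{Inf (snd i)<..<Sup (snd i)} \<inter> {Inf (snd j)<..<Sup (snd j)} = {}"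
      by (simp only: K(1) ij)
  qed
  have "finite q"
    using p q finite_subset by blast
  have "ennreal (\<Sum>i\<in>q. Sup (snd i) - Inf (snd i)) = (\<Sum>i\<in>q. emeasure lebesgue {Inf (snd i)<..<Sup (snd i)})"
    by (subst sum_ennreal[symmetric]) (auto intro!: sum.cong simp: K(2))
  also have "\<dots> = emeasure lebesgue (\<Union>i\<in>q. {Inf (snd i)<..<Sup (snd i)})"
    using \<open>finite q\<close> disj by (intro sum_emeasure) auto
  also have "\<dots> \<le> emeasure lebesgue U"
    using U K(1) interior_subset by (intro emeasure_mono UN_least) blast+
  also note emU
  finally show "(\<Sum>i\<in>q. Sup (snd i) - Inf (snd i)) < \<delta>"
    by (simp add: ennreal_less_iff sum_nonneg K(2))
qed

text \<open>
  The increment of \<open>f\<close> is split along a tagged division that is fine for a gauge of the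
  Henstock--Kurzweil integral of \<open>g\<close>. Tags in \<open>N\<close> have their intervals inside an open set of small
  measure, where absolute continuity bounds the increments; at the other tags the derivative does.
\<close>

lemma abs_cont_on_increment_le_integral:
  fixes f g :: "real \<Rightarrow> real"
  assumes "a \<le> b" and f: "abs_cont_on {a..b} f" and g: "g integrable_on {a..b}"
    and N: "negligible N"
    and f': "\<And>t. t \<in> {a..b} - N \<Longrightarrow> (f has_vector_derivative f' t) (at t within {a..b})"
    and le: "\<And>t. t \<in> {a..b} - N \<Longrightarrow> f' t \<le> g t"
  shows "f b - f a \<le> integral {a..b} g"
proof (rule field_le_epsilon)
  fix \<eta> :: real assume "\<eta> > 0"
  \<comment> \<open>The error budget: \<open>e * (b - a)\<close> for the linear approximations,
    \<open>e\<close> for the Riemann sum and \<open>e\<close> for the increments at tags in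
    \<open>N\<close>.\<close>
  define e where "e = \<eta> / (b - a + 2)"
  have "e > 0" "e * (b - a + 2) = \<eta>"
    using \<open>\<eta> > 0\<close> \<open>a \<le> b\<close> by (simp_all add: e_def)
  then have e: "e > 0" "e * (b - a) + e + e = \<eta>"
    by (simp_all add: algebra_simps)
  obtain \<delta> where \<delta>: "\<delta> > 0"
    "\<forall>(I :: (real \<times> real set) set) l r. finite I \<longrightarrow>
       (\<forall>i\<in>I. l i \<le> r i \<and> {l i..r i} \<subseteq> {a..b}) \<longrightarrow>
       disjoint_family_on (\<lambda>i. {l i<..<r i}) I \<longrightarrow> (\<Sum>i\<in>I. r i - l i) < \<delta> \<longrightarrow>
       (\<Sum>i\<in>I. norm (f (r i) - f (l i))) < e"
    using abs_cont_on_finite_family[OF f e(1)] by (elim exE conjE)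
  have null: "N \<in> null_sets lebesgue"
    using N by (simp add: negligible_iff_null_sets)
  obtain U where U: "open U" "N \<subseteq> U" "U - N \<in> lmeasurable" "emeasure lebesgue (U - N) < ennreal \<delta>"
    using sets_lebesgue_outer_open[of N \<delta>] null \<delta>(1) by blast
  \<comment> \<open>Outer regularity bounds the measure of \<open>U - N\<close>; since
    \<open>N\<close> is null, \<open>U\<close> has the same measure.\<close>
  have U': "U \<in> sets lebesgue" "emeasure lebesgue U < ennreal \<delta>"
    using U null by (auto simp: emeasure_Diff_null_set)
  \<comment> \<open>On \<open>N\<close> nothing relates \<open>g\<close> to \<open>f\<close>.
    Setting it to 0 there leaves the integral unchanged and removes these tags from the Riemann
    sum.\<close>
  define g0 where "g0 t = (if t \<in> N then 0 else g t)" for t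
  have g0: "(g0 has_integral integral {a..b} g) {a..b}"
    using g by (intro has_integral_spike[OF N _ integrable_integral]) (auto simp: g0_def)
  obtain \<gamma>1 where \<gamma>1: "gauge \<gamma>1"
    "\<And>p. p tagged_division_of {a..b} \<Longrightarrow> \<gamma>1 fine p \<Longrightarrow>
       \<bar>(\<Sum>(x, K)\<in>p. measure lborel K *\<^sub>R g0 x) - integral {a..b} g\<bar> < e"
    using g0[unfolded has_integral_real] e(1) by (metis real_norm_def)
  \<comment> \<open>The radius \<open>d t\<close> of the second gauge: it keeps the intervals tagged
    in \<open>N\<close> inside \<open>U\<close> and makes the linear approximation at every other
    tag accurate up to the slope error \<open>e\<close>.\<close>
  have "\<forall>t. \<exists>d>0. (t \<in> N \<longrightarrow> ball t d \<subseteq> U) \<and> (t \<in> {a..b} - N \<longrightarrow>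
      (\<forall>s\<in>{a..b}. norm (s - t) < d \<longrightarrow> norm (f s - f t - (s - t) *\<^sub>R f' t) \<le> e * norm (s - t)))"
  proof
    fix t
    consider "t \<in> N" | "t \<in> {a..b} - N" | "t \<notin> {a..b} \<union> N" by blast
    then show "\<exists>d>0. (t \<in> N \<longrightarrow> ball t d \<subseteq> U) \<and> (t \<in> {a..b} - N \<longrightarrow>
      (\<forall>s\<in>{a..b}. norm (s - t) < d \<longrightarrow> norm (f s - f t - (s - t) *\<^sub>R f' t) \<le> e * norm (s - t)))"
    proof cases
      case 1
      then show ?thesis using U by (meson DiffE open_contains_ball subsetD)
    next
      case 2
      then show ?thesis
        using f'[OF 2] e(1) unfolding has_vector_derivative_def has_derivative_within_alt by blast
    next
      case 3
      then show ?thesis using zero_less_one by blast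
    qed
  qed
  then obtain d where d: "\<And>t. d t > 0" "\<And>t. t \<in> N \<Longrightarrow> ball t (d t) \<subseteq> U"
    "\<And>t s. t \<in> {a..b} - N \<Longrightarrow> s \<in> {a..b} \<Longrightarrow> norm (s - t) < d t \<Longrightarrow>
        norm (f s - f t - (s - t) *\<^sub>R f' t) \<le> e * norm (s - t)"
    by metis
  have "gauge (\<lambda>t. \<gamma>1 t \<inter> ball t (d t))"
    using \<gamma>1(1) d(1) by (intro gauge_Int gauge_ball_dependent) auto
  then obtain p where p: "p tagged_division_of {a..b}" "(\<lambda>t. \<gamma>1 t \<inter> ball t (d t)) fine p"
    using fine_division_exists_real by blast
  then have fine: "\<gamma>1 fine p" "(\<lambda>t. ball t (d t)) fine p"
    by (simp_all add: fine_Int)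
  have "finite p"
    using p(1) by blast
  define q where "q = {i \<in> p. fst i \<in> N}"
  have q: "q \<subseteq> p" "finite q"
    using \<open>finite p\<close> by (auto simp: q_def)
  have pK: "K = {Inf K..Sup K}" "Inf K \<le> x" "x \<le> Sup K"
    "{Inf K..Sup K} \<subseteq> {a..b}" "{Inf K..Sup K} \<subseteq> ball x (d x)"
    if xK: "(x, K) \<in> p" for x K
  proof -
    obtain u v where "K = {u..v}"
      using tagged_division_ofD(4)[OF p(1) xK] by auto
    then show "K = {Inf K..Sup K}" "Inf K \<le> x" "x \<le> Sup K"
      "{Inf K..Sup K} \<subseteq> {a..b}" "{Inf K..Sup K} \<subseteq> ball x (d x)"
      using tagged_division_ofD(2,3)[OF p(1) xK] fineD[OF fine(2) xK] by auto
  qed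
  have qU: "snd i \<subseteq> U" if "i \<in> q" for i
  proof -
    have "(fst i, snd i) \<in> p" "fst i \<in> N"
      using that by (auto simp: q_def)
    then show ?thesis
      using pK(1,5) d(2) by (metis subset_trans)
  qed
  note disj = tagged_subdivision_total_length[OF p(1) q(1) U'(1) qU U'(2)]
  have small: "(\<Sum>i\<in>q. norm (f (Sup (snd i)) - f (Inf (snd i)))) < e"
  proof (rule \<delta>(2)[rule_format, OF q(2)])
    show "Inf (snd i) \<le> Sup (snd i) \<and> {Inf (snd i)..Sup (snd i)} \<subseteq> {a..b}" if "i \<in> q" for i
    proof -
      have "(fst i, snd i) \<in> p"
        using that q(1) by auto
      from pK(2-4)[OF this] show ?thesis
        by auto
    qed
  qed (use disj in simp_all)
  define \<Delta> where "\<Delta> i = f (Sup (snd i)) - f (Inf (snd i))" for i :: "real \<times> real set"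
  \<comment> \<open>The summands separate the errors: at a tag in \<open>N\<close> the last one
    dominates \<open>\<Delta> i\<close>, at any other tag the first two do.\<close>
  have each: "\<Delta> i \<le> measure lborel (snd i) * g0 (fst i) + e * measure lborel (snd i) +
      (if fst i \<in> N then \<bar>\<Delta> i\<bar> else 0)" if "i \<in> p" for i
  proof -
    obtain x K where i: "i = (x, K)" by fastforce
    define u v where uv: "u = Inf K" "v = Sup K"
    have "(x, K) \<in> p"
      using that i by simp
    note K = pK(1-3)[OF this, folded uv] and sub = pK(4,5)[OF this, folded uv]
    have cont: "measure lborel K = v - u"
      using K by simp
    show ?thesis
    proof (cases "x \<in> N")
      case True
      moreover have "0 \<le> e * measure lborel K"
        using e(1) by simp
      ultimately show ?thesis
        using abs_ge_self[of "\<Delta> i"] by (simp add: g0_def i)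
    next
      case False
      have x: "x \<in> {a..b} - N" and u: "u \<in> {a..b}" "norm (u - x) < d x"
        and v: "v \<in> {a..b}" "norm (v - x) < d x"
        using subsetD[OF sub(1), of x] subsetD[OF sub(1), of u] subsetD[OF sub(1), of v]
          subsetD[OF sub(2), of u] subsetD[OF sub(2), of v] K(2,3) False
        by (simp_all add: dist_norm norm_minus_commute)
      \<comment> \<open>The tag lies between the endpoints \<open>u\<close> and \<open>v\<close>, so
        the one-sided errors add up to exactly \<open>e * (v - u)\<close>.\<close>
      have "f v - f x \<le> (v - x) * f' x + e * (v - x)" "f x - f u \<le> (x - u) * f' x + e * (x - u)"
        using d(3)[OF x u] d(3)[OF x v] K(2,3) by (simp_all add: abs_le_iff algebra_simps)
      then have "f v - f u \<le> (v - u) * f' x + e * (v - u)"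
        by (simp add: algebra_simps)
      also have "\<dots> \<le> (v - u) * g x + e * (v - u)"
        using le[OF x] K(2,3) by (intro add_right_mono mult_left_mono) auto
      finally show ?thesis
        using False by (simp add: g0_def \<Delta>_def i cont flip: uv)
    qed
  qed
  have len: "(\<Sum>i\<in>p. measure lborel (snd i)) = b - a"
    using additive_content_tagged_division[of p a b] p(1) \<open>a \<le> b\<close> by (simp add: case_prod_beta)
  have "\<bar>(\<Sum>i\<in>p. measure lborel (snd i) * g0 (fst i)) - integral {a..b} g\<bar> < e"
    using \<gamma>1(2)[OF p(1) fine(1)] by (simp add: case_prod_unfold)
  then have riemann: "(\<Sum>i\<in>p. measure lborel (snd i) * g0 (fst i)) \<le> integral {a..b} g + e"
    by linarith
  have "f b - f a = (\<Sum>i\<in>p. \<Delta> i)"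
    using additive_tagged_division_1[OF \<open>a \<le> b\<close> p(1), of f] by (simp add: \<Delta>_def case_prod_beta)
  also have "\<dots> \<le> (\<Sum>i\<in>p. measure lborel (snd i) * g0 (fst i) + e * measure lborel (snd i) +
      (if fst i \<in> N then \<bar>\<Delta> i\<bar> else 0))"
    by (intro sum_mono each)
  also have "\<dots> = (\<Sum>i\<in>p. measure lborel (snd i) * g0 (fst i)) + e * (b - a) + (\<Sum>i\<in>q. \<bar>\<Delta> i\<bar>)"
    using \<open>finite p\<close> len by (simp add: sum.distrib q_def sum.inter_filter flip: sum_distrib_left)
  also have "\<dots> \<le> (integral {a..b} g + e) + e * (b - a) + e"
    using riemann small[folded \<Delta>_def, unfolded real_norm_def] by linarith
  finally show "f b - f a \<le> integral {a..b} g + \<eta>"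
    using e(2) by simp
qed

section \<open>Integrating the dissipation inequality\<close>

lemma set_integral_L2_inner:
  assumes f: "f \<in> L2" and g: "g \<in> L2"
  shows "set_integrable lebesgue {0..} (\<lambda>t. f t \<bullet> g t)"
proof -
  have meas: "(\<lambda>t. indicator {0..} t *\<^sub>R f t) \<in> borel_measurable lebesgue"
    "(\<lambda>t. indicator {0..} t *\<^sub>R g t) \<in> borel_measurable lebesgue"
    and int: "set_integrable lebesgue {0..} (\<lambda>t. (norm (f t))\<^sup>2)"
    "set_integrable lebesgue {0..} (\<lambda>t. (norm (g t))\<^sup>2)"
    using f g by (auto simp: L2_def set_borel_measurable_def)
  \<comment> \<open>The indicator is idempotent, so both factors can be truncated; measurability is
    known only for the truncations.\<close>
  have eq: "(\<lambda>t. indicator {0..} t *\<^sub>R (f t \<bullet> g t)) =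
      (\<lambda>t. (indicator {0..} t *\<^sub>R f t) \<bullet> (indicator {0..} t *\<^sub>R g t))"
    by (auto simp: indicator_def)
  have "(\<lambda>t. (indicator {0..} t *\<^sub>R f t) \<bullet> (indicator {0..} t *\<^sub>R g t)) \<in> borel_measurable lebesgue"
    using meas by (rule borel_measurable_inner)
  then have m: "set_borel_measurable lebesgue {0..} (\<lambda>t. f t \<bullet> g t)"
    unfolding set_borel_measurable_def eq .
  \<comment> \<open>The integrable majorant: Cauchy-Schwarz followed by the inequality between
    arithmetic and geometric means.\<close>
  have "\<bar>u \<bullet> v\<bar> \<le> (norm u)\<^sup>2 + (norm v)\<^sup>2" for u v :: "real ^ 'a"
    using Cauchy_Schwarz_ineq2[of u v] sum_squares_bound[of "norm u" "norm v"]
      mult_nonneg_nonneg[of "norm u" "norm v"] by simp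
  then show ?thesis
    by (intro set_integrable_bound[OF set_integral_add(1)[OF int] m]) auto
qed

text \<open>Here \<open>x'\<close> stands for the right-hand side of the state equation and
  \<open>g\<close> for the supply rate. Keeping both abstract isolates the integration argument from
  the operators of the system.\<close>

lemma dissipation_integral_nonneg:
  fixes P :: "'z::{real_inner, banach} \<Rightarrow> 'z" and x x' :: "real \<Rightarrow> 'z" and g :: "real \<Rightarrow> real"
  assumes P: "linear P" "coercive P" "self_adjoint P"
    and x: "locally_abs_cont_on {0..} x" "x 0 = 0"
    and g: "set_integrable lebesgue {0..} g"
    and ae: "AE t in lebesgue. t \<ge> 0 \<longrightarrow> (x has_vector_derivative x' t) (at t within {0..}) \<and>
        x t \<bullet> P (x' t) + x' t \<bullet> P (x t) \<le> g t"
  shows "(LINT t:{0..}|lebesgue. g t) \<ge> 0"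
proof -
  have bl: "bounded_linear P"
    using P by (intro symmetric_bounded_linear)
  have coer: "z \<bullet> P z \<ge> 0" for z
    using P(2) unfolding coercive_def by (meson less_imp_le mult_nonneg_nonneg order_trans zero_le_power2)
  obtain N where N: "N \<in> null_sets lebesgue"
    "\<And>t. t \<notin> N \<Longrightarrow> t \<ge> 0 \<Longrightarrow> (x has_vector_derivative x' t) (at t within {0..}) \<and>
        x t \<bullet> P (x' t) + x' t \<bullet> P (x t) \<le> g t"
    using AE_E3[OF ae] by auto
  have nonneg: "(LINT t:{0..T}|lebesgue. g t) \<ge> 0" if "T \<ge> 0" for T
  proof -
    have gT: "set_integrable lebesgue {0..T} g"
      by (rule set_integrable_subset[OF g]) auto
    have "x T \<bullet> P (x T) - x 0 \<bullet> P (x 0) \<le> integral {0..T} g"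
    proof (rule abs_cont_on_increment_le_integral[OF that])
      show "abs_cont_on {0..T} (\<lambda>t. x t \<bullet> P (x t))"
        using x(1) by (intro abs_cont_on_quadratic_form bl) (simp add: locally_abs_cont_on_def)
      show "g integrable_on {0..T}"
        using gT by (rule set_lebesgue_integral_eq_integral)
      show "negligible N"
        using N(1) by (simp add: negligible_iff_null_sets)
      fix t assume t: "t \<in> {0..T} - N"
      then have "(x has_vector_derivative x' t) (at t within {0..})"
        using N(2)[of t] by simp
      \<comment> \<open>At 0 the derivative is one-sided; passing to \<open>{0..T}\<close> makes it
        one-sided at \<open>T\<close> as well, as the increment estimate expects.\<close>
      then have x': "(x has_vector_derivative x' t) (at t within {0..T})"
        by (rule has_vector_derivative_within_subset) auto
      show "((\<lambda>t. x t \<bullet> P (x t)) has_vector_derivative (x t \<bullet> P (x' t) + x' t \<bullet> P (x t)))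
          (at t within {0..T})"
        by (rule bounded_bilinear.has_vector_derivative[OF bounded_bilinear_inner x'
              bounded_linear.has_vector_derivative[OF bl x']])
      show "x t \<bullet> P (x' t) + x' t \<bullet> P (x t) \<le> g t"
        using N(2)[of t] t by auto
    qed
    then show ?thesis
      using coer[of "x T"] set_lebesgue_integral_eq_integral(2)[OF gT] x(2) by simp
  qed
  \<comment> \<open>Integrability over the whole half-line makes the truncated integrals converge,
    and their lower bound 0 survives the limit.\<close>
  have "((\<lambda>T. LINT t:{0..T}|lebesgue. g t) \<longlongrightarrow> (LINT t:{0..}|lebesgue. g t)) at_top"
    using g by (intro tendsto_set_lebesgue_integral_at_top) auto
  then show ?thesis
    by (rule tendsto_lowerbound)
      (use nonneg in \<open>auto intro: eventually_mono[OF eventually_ge_at_top[of 0]]\<close>)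
qed

text \<open>The pointwise inequality is evaluated at \<open>z = x t\<close> and
  \<open>u = w t\<close>. The output equation turns \<open>C z + D u\<close> into
  \<open>y t\<close>, so a supply rate in \<open>u\<close> and \<open>C z + D u\<close> becomes one
  in the signals \<open>w\<close> and \<open>y\<close>.\<close>

lemma satisfies_system_supply_rate:
  fixes X :: "'z::{real_inner, banach} set"
    and \<sigma> :: "real ^ 'm \<Rightarrow> real ^ 'q \<Rightarrow> real"
  assumes P: "linear P" "coercive P" "self_adjoint P"
    and sys: "satisfies_system X A B C D w y x"
    and int: "set_integrable lebesgue {0..} (\<lambda>t. \<sigma> (w t) (y t))"
    and diss: "\<And>z u. z \<in> X \<Longrightarrow>
      z \<bullet> P (A z) + A z \<bullet> P z + z \<bullet> P (B u) + B u \<bullet> P z \<le> \<sigma> u (C z + D u)"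
  shows "(LINT t:{0..}|lebesgue. \<sigma> (w t) (y t)) \<ge> 0"
proof (rule dissipation_integral_nonneg[OF P _ _ int])
  show "locally_abs_cont_on {0..} x" "x 0 = 0"
    using sys by (auto simp: satisfies_system_def)
  have "AE t in lebesgue. t \<ge> 0 \<longrightarrow> x t \<in> X \<and>
      (x has_vector_derivative A (x t) + B (w t)) (at t within {0..}) \<and> y t = C (x t) + D (w t)"
    using sys by (simp add: satisfies_system_def)
  then show "AE t in lebesgue. t \<ge> 0 \<longrightarrow>
      (x has_vector_derivative A (x t) + B (w t)) (at t within {0..}) \<and>
      x t \<bullet> P (A (x t) + B (w t)) + (A (x t) + B (w t)) \<bullet> P (x t) \<le> \<sigma> (w t) (y t)"
  proof eventually_elim
    case (elim t)
    show ?case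
    proof
      assume "t \<ge> 0"
      then show "(x has_vector_derivative A (x t) + B (w t)) (at t within {0..}) \<and>
          x t \<bullet> P (A (x t) + B (w t)) + (A (x t) + B (w t)) \<bullet> P (x t) \<le> \<sigma> (w t) (y t)"
        using elim diss[of "x t" "w t"]
        by (simp add: linear_add[OF P(1)] inner_add_left inner_add_right)
    qed
  qed
qed

section \<open>The bounded-gain and passivity supply rates\<close>

theorem theorem3:
  fixes X :: "'z::{real_inner, banach} set"
    and A :: "'z \<Rightarrow> 'z"
    and C :: "'z \<Rightarrow> real ^ 'q"
  assumes "subspace X" and "linear_on X A" and "linear_on X C"
  shows
    "(\<forall>(B :: real ^ 'm \<Rightarrow> 'z) (D :: real ^ 'm \<Rightarrow> real ^ 'q) (\<gamma> :: real).
        linear B \<longrightarrow> linear D \<longrightarrow> \<gamma> \<ge> 0 \<longrightarrow>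
        (\<exists>P. linear P \<and> coercive P \<and> self_adjoint P \<and>
           (\<forall>z\<in>X. \<forall>u.
              z \<bullet> P (A z) + A z \<bullet> P z + z \<bullet> P (B u) + B u \<bullet> P z
                \<le> \<gamma>\<^sup>2 * (u \<bullet> u) - C z \<bullet> C z - C z \<bullet> D u - D u \<bullet> C z - D u \<bullet> D u)) \<longrightarrow>
        (\<forall>w\<in>L2. \<forall>y\<in>L2. (\<exists>x. satisfies_system X A B C D w y x) \<longrightarrow>
           L2_norm y \<le> \<gamma> * L2_norm w)) \<and>
     (\<forall>(B :: real ^ 'q \<Rightarrow> 'z) (D :: real ^ 'q \<Rightarrow> real ^ 'q).
        linear B \<longrightarrow> linear D \<longrightarrow>
        (\<exists>P. linear P \<and> coercive P \<and> self_adjoint P \<and>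
           (\<forall>z\<in>X. \<forall>u.
              z \<bullet> P (A z) + A z \<bullet> P z + z \<bullet> P (B u) + B u \<bullet> P z
                \<le> C z \<bullet> u + u \<bullet> C z + D u \<bullet> u + u \<bullet> D u)) \<longrightarrow>
        (\<forall>w\<in>L2. \<forall>y\<in>L2. (\<exists>x. satisfies_system X A B C D w y x) \<longrightarrow>
           L2_inner w y \<ge> 0))"
proof (intro conjI allI impI ballI; elim exE conjE)
  fix B :: "real ^ 'm \<Rightarrow> 'z" and D :: "real ^ 'm \<Rightarrow> real ^ 'q" and \<gamma> :: real and w y P x
  assume "\<gamma> \<ge> 0" and w: "w \<in> L2" and y: "y \<in> L2"
    and P: "linear P" "coercive P" "self_adjoint P"
    and diss: "\<forall>z\<in>X. \<forall>u. z \<bullet> P (A z) + A z \<bullet> P z + z \<bullet> P (B u) + B u \<bullet> P z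
      \<le> \<gamma>\<^sup>2 * (u \<bullet> u) - C z \<bullet> C z - C z \<bullet> D u - D u \<bullet> C z - D u \<bullet> D u"
    and sys: "satisfies_system X A B C D w y x"
  \<comment> \<open>With \<open>v = C z + D u\<close>, expanding \<open>v \<bullet> v\<close> yields
    precisely the four output terms of \<open>diss\<close>.\<close>
  define \<sigma> where "\<sigma> u v = \<gamma>\<^sup>2 * (u \<bullet> u) - v \<bullet> v" for u :: "real ^ 'm" and v :: "real ^ 'q"
  have int: "set_integrable lebesgue {0..} (\<lambda>t. \<gamma>\<^sup>2 * (w t \<bullet> w t))"
    "set_integrable lebesgue {0..} (\<lambda>t. y t \<bullet> y t)"
    using w y by (auto intro: set_integral_L2_inner)
  have "(LINT t:{0..}|lebesgue. \<sigma> (w t) (y t)) \<ge> 0"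
  proof (rule satisfies_system_supply_rate[OF P sys])
    show "set_integrable lebesgue {0..} (\<lambda>t. \<sigma> (w t) (y t))"
      unfolding \<sigma>_def by (rule set_integral_diff(1)[OF int])
    show "z \<bullet> P (A z) + A z \<bullet> P z + z \<bullet> P (B u) + B u \<bullet> P z \<le> \<sigma> u (C z + D u)" if "z \<in> X" for z u
      using bspec[OF diss that, THEN spec, of u]
      by (simp add: \<sigma>_def inner_add_left inner_add_right)
  qed
  then have "L2_inner y y \<le> \<gamma>\<^sup>2 * L2_inner w w"
    unfolding \<sigma>_def L2_inner_def by (simp add: set_integral_diff(2)[OF int])
  then have "sqrt (L2_inner y y) \<le> sqrt (\<gamma>\<^sup>2 * L2_inner w w)"
    by (rule real_sqrt_le_mono)
  then show "L2_norm y \<le> \<gamma> * L2_norm w"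
    using \<open>\<gamma> \<ge> 0\<close> by (simp add: L2_norm_def real_sqrt_mult)
next
  fix B :: "real ^ 'q \<Rightarrow> 'z" and D :: "real ^ 'q \<Rightarrow> real ^ 'q" and w y P x
  assume w: "w \<in> L2" and y: "y \<in> L2"
    and P: "linear P" "coercive P" "self_adjoint P"
    and diss: "\<forall>z\<in>X. \<forall>u. z \<bullet> P (A z) + A z \<bullet> P z + z \<bullet> P (B u) + B u \<bullet> P z
      \<le> C z \<bullet> u + u \<bullet> C z + D u \<bullet> u + u \<bullet> D u"
    and sys: "satisfies_system X A B C D w y x"
  \<comment> \<open>The factor 2 comes from the symmetrized right-hand side of \<open>diss\<close>,
    where each inner product occurs in both orders.\<close>
  have "(LINT t:{0..}|lebesgue. 2 * (w t \<bullet> y t)) \<ge> 0"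
  proof (rule satisfies_system_supply_rate[OF P sys])
    show "set_integrable lebesgue {0..} (\<lambda>t. 2 * (w t \<bullet> y t))"
      using set_integral_L2_inner[OF w y] by simp
    show "z \<bullet> P (A z) + A z \<bullet> P z + z \<bullet> P (B u) + B u \<bullet> P z \<le> 2 * (u \<bullet> (C z + D u))"
      if "z \<in> X" for z u
      using bspec[OF diss that, THEN spec, of u]
      by (simp add: inner_add_right inner_commute)
  qed
  then show "L2_inner w y \<ge> 0"
    by (simp add: L2_inner_def)
qed

end
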